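(* Consider the two-step parareal algorithm (described in the context) with the two-step coarse propagator $\mathcal G^*$ determined by the rational functions $R_1,R_2$ and the single-step fine propagator $\mathcal F$ with stability function $r$. For $s\in\mathbb R_+=(0,\infty)$ let $\rho_1(s),\rho_2(s)\in\mathbb C$ be defined by $$\rho_1(s)+\rho_2(s)=R_2(s),\qquad \rho_1(s)\rho_2(s)=-R_1(s),$$ and suppose that $|\rho_1(s)|<1$ and $|\rho_2(s)|<1$ for all $s\in\mathbb R_+$. Define the convergence factor $$\gamma^*(r,R_1,R_2,J)=\sup_{s\in\mathbb R_+}\frac{\bigl|r(2s/J)^J-R_2(s)\,r(2s/J)^{J/2}-R_1(s)\bigr|}{(1-|\rho_1(s)|)(1-|\rho_2(s)|)}.$$ Then there exists a constant $c$ independent of the iteration index $k$ such that for all $k\ge 0$ $$\max_{0\le m\le 2N_c}\|U^k_{m/2}-U_{m/2}\|_{L^2(\Omega)}\le c\,\gamma^*(r,R_1,R_2,J)^k,$$ where $U^k_{m/2}$ are the parareal iterates and $U_{m/2}$ is the fine solution.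
   Context: **Problem.** $T>0$, $\Omega\subset\mathbb R^d$ ($d\ge1$) is a Lipschitz domain, and $A$ is a positive definite self-adjoint linear elliptic operator on $L^2(\Omega)$ with dense domain $D(A)$, having eigenpairs $\{(\lambda_p,\varphi_p)\}_{p\ge1}$, $\lambda_p>0$, with $\{\varphi_p\}$ an orthonormal basis of $L^2(\Omega)$. Let $u_0\in L^2(\Omega)$ and $f\in L^2(0,T;L^2(\Omega))$, with point values $f(t)\in L^2(\Omega)$ assumed to be defined at all times where they are used. The problem to be approximated is $u'(t)+Au(t)=f(t)$, $0<t<T$, $u(0)=u_0$. **Grids.** $J$ is a positive even integer, $\Delta t>0$ is the fine step, $\Delta T=J\Delta t$ is the coarse step, $N_c=T/\Delta T$ is a positive integer, and $T_\nu=\nu\Delta T$ for $\nu\in\{0,\tfrac12,1,\dots,N_c\}$. Functions of $A$ are defined by the spectral calculus: $g(A)\varphi_p=g(\lambda_p)\varphi_p$. **Fine propagator.** $\mathcal F(t,\Delta t,v)=r(\Delta tA)v+\Delta t\sum_{i=1}^{m_0}p_i(\Delta tA)f(t+c_i\Delta t)$, where $r,p_i$ are rational functions and the $c_i\in[0,1]$ are distinct. For $v\in L^2(\Omega)$ and a starting time $T_\nu$, put $v_0=v$ and $v_{j+1}=\mathcal F(T_\nu+j\Delta t,\Delta t,v_j)$; set $\mathcal F_{\Delta T/2}(T_\nu,v)=v_{J/2}$ and $\mathcal F_{\Delta T}(T_\nu,v)=v_J$. **Fine solution.** $U_0=u_0$, $U_{n+1/2}=\mathcal F_{\Delta T/2}(T_n,U_n)$,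 $U_{n+1}=\mathcal F_{\Delta T}(T_n,U_n)$ for $n=0,\dots,N_c-1$. **Coarse propagators.** $\mathcal G(t,\tau,v)=R(\tau A)v+\tau\sum_{i=1}^{M}P_i(\tau A)f(t+C_i\tau)$ is a single-step scheme ($R,P_i$ rational functions, $C_i\in[0,1]$). The two-step coarse propagator, with data $v_1$ at time $t-\tau$ and $v_2$ at time $t$, is $$\mathcal G^*(t,\tau,v_1,v_2)=R_1(\tau A)v_1+R_2(\tau A)v_2+\tau(\alpha_2+\beta_2\tau A)^{-1}\sum_{i=0}^2\beta_if(t+(i-1)\tau),$$ $$R_1(s)=\frac{-\alpha_0-\beta_0s}{\alpha_2+\beta_2s},\qquad R_2(s)=\frac{-\alpha_1-\beta_1s}{\alpha_2+\beta_2s},$$ with real $\alpha_i,\beta_i$. The underlying linear two-step scheme is assumed to be of order $q_0$ for some integer $q_0\ge0$: $\sum_{i=0}^2\alpha_i=0$ and $\sum_{i=0}^2\alpha_i i^p=p\sum_{i=0}^2\beta_i i^{p-1}$ for $p=1,\dots,q_0$ (with $0^0=1$; for $q_0=0$ only the first condition is required). All the rational functions of $A$ above are assumed to have no poles on $[0,\infty)$ and to define bounded operators on $L^2(\Omega)$. **Two-step parareal algorithm.** Initialization: $U_0^0=u_0$, $U^0_{1/2}=\mathcal G(T_0,\Delta T/2,U_0^0)$, and $U^0_{m/2+1}=\mathcal G^*(T_{(m+1)/2},\Delta T/2,U^0_{m/2},U^0_{(m+1)/2})$ for $m=0,\dots,2N_c-2$. Then the two values $U^0_{1/2}$ and $U^0_1$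 are replaced by the fine values $\mathcal F_{\Delta T/2}(T_0,u_0)$ and $\mathcal F_{\Delta T}(T_0,u_0)$. Iteration $k=0,1,2,\dots$: set $U_0^{k+1}=u_0$, $U_{1/2}^{k+1}=U_{1/2}^0$, $U_1^{k+1}=U_1^0$, and for $m=1,\dots,2N_c-2$ successively $$U^{k+1}_{m/2+1}=\mathcal G^*\bigl(T_{(m+1)/2},\tfrac{\Delta T}2,U^{k+1}_{m/2},U^{k+1}_{(m+1)/2}\bigr)+\mathcal F_{\Delta T}(T_{m/2},U^k_{m/2})-\mathcal G^*\bigl(T_{(m+1)/2},\tfrac{\Delta T}2,U^{k}_{m/2},\mathcal F_{\Delta T/2}(T_{m/2},U^k_{m/2})\bigr).$$ *)

theory Defs
  imports "HOL-Analysis.Analysis" "HOL-Computational_Algebra.Polynomial"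
begin

section \<open>The space of square-integrable functions\<close>

definition sq_integrable :: "('a::euclidean_space \<Rightarrow> real) \<Rightarrow> bool" where
  "sq_integrable u \<longleftrightarrow> u \<in> borel_measurable lebesgue \<and> integrable lebesgue (\<lambda>x. (u x)\<^sup>2)"

lemma sq_integrable_measurable [measurable_dest]:
  "sq_integrable u \<Longrightarrow> u \<in> borel_measurable lebesgue"
  by (simp add: sq_integrable_def)

lemma sq_integrable_times:
  assumes "sq_integrable u" "sq_integrable v"
  shows "integrable lebesgue (\<lambda>x. u x * v x)"
proof (rule Bochner_Integration.integrable_bound)
  show "integrable lebesgue (\<lambda>x. (u x)\<^sup>2 + (v x)\<^sup>2)"
    using assms by (auto simp: sq_integrable_def)
  show "(\<lambda>x. u x * v x) \<in> borel_measurable lebesgue"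
    using assms by (auto simp: sq_integrable_def)
  have "\<bar>a * b\<bar> \<le> a\<^sup>2 + b\<^sup>2" for a b :: real
  proof -
    have "2 * (\<bar>a\<bar> * \<bar>b\<bar>) \<le> a\<^sup>2 + b\<^sup>2"
      using sum_squares_bound[of "\<bar>a\<bar>" "\<bar>b\<bar>"] by (simp add: mult.assoc)
    moreover have "0 \<le> \<bar>a\<bar> * \<bar>b\<bar>" by simp
    ultimately show ?thesis by (simp only: abs_mult)
  qed
  then show "AE x in lebesgue. norm (u x * v x) \<le> norm ((u x)\<^sup>2 + (v x)\<^sup>2)"
    by auto
qed

lemma sq_integrable_add:
  assumes "sq_integrable u" "sq_integrable v"
  shows "sq_integrable (\<lambda>x. u x + v x)"
  using assms sq_integrable_times[OF assms]
  by (auto simp: sq_integrable_def power2_sum mult.assoc)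

lemma sq_integrable_scale:
  assumes "sq_integrable u"
  shows "sq_integrable (\<lambda>x. a * u x)"
  using assms by (auto simp: sq_integrable_def power_mult_distrib)

lemma sq_integrable_uminus: "sq_integrable u \<Longrightarrow> sq_integrable (\<lambda>x. - u x)"
  using sq_integrable_scale[of u "-1"] by simp

lemma sq_integrable_diff:
  "sq_integrable u \<Longrightarrow> sq_integrable v \<Longrightarrow> sq_integrable (\<lambda>x. u x - v x)"
  using sq_integrable_add[of u "\<lambda>x. - v x"] by (simp add: sq_integrable_uminus)

lemma sq_integrable_zero: "sq_integrable (\<lambda>x. 0)"
  by (simp add: sq_integrable_def)

quotient_type (overloaded) 'a L2 = "'a::euclidean_space \<Rightarrow> real" / partial:
  "\<lambda>u v. sq_integrable u \<and> sq_integrable v \<and> (AE x in lebesgue. u x = v x)"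
proof (rule part_equivpI)
  show "\<exists>u::'a \<Rightarrow> real. sq_integrable u \<and> sq_integrable u \<and> (AE x in lebesgue. u x = u x)"
    using sq_integrable_zero by blast
  show "symp (\<lambda>u v::'a \<Rightarrow> real. sq_integrable u \<and> sq_integrable v \<and> (AE x in lebesgue. u x = v x))"
    by (rule sympI) (auto simp: eq_commute)
  show "transp (\<lambda>u v::'a \<Rightarrow> real. sq_integrable u \<and> sq_integrable v \<and> (AE x in lebesgue. u x = v x))"
    by (rule transpI) (auto elim: AE_mp)
qed

instantiation L2 :: (euclidean_space) real_vector
begin

lift_definition zero_L2 :: "'a L2" is "\<lambda>x. 0"
  by (simp add: sq_integrable_zero)

lift_definition plus_L2 :: "'a L2 \<Rightarrow> 'a L2 \<Rightarrow> 'a L2" is "\<lambda>u v x. u x + v x"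
  by (auto intro: sq_integrable_add elim: AE_mp)

lift_definition scaleR_L2 :: "real \<Rightarrow> 'a L2 \<Rightarrow> 'a L2" is "\<lambda>a u x. a * u x"
  by (auto intro: sq_integrable_scale elim: AE_mp)

lift_definition uminus_L2 :: "'a L2 \<Rightarrow> 'a L2" is "\<lambda>u x. - u x"
  by (auto intro: sq_integrable_uminus elim: AE_mp)

lift_definition minus_L2 :: "'a L2 \<Rightarrow> 'a L2 \<Rightarrow> 'a L2" is "\<lambda>u v x. u x - v x"
  by (auto intro: sq_integrable_diff elim: AE_mp)

instance
proof
  fix a b :: real and u v w :: "'a L2"
  show "u + v + w = u + (v + w)"
    by transfer (auto intro: sq_integrable_add simp: add.assoc)
  show "u + v = v + u"
    by transfer (auto intro: sq_integrable_add simp: add.commute)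
  show "0 + u = u"
    by transfer auto
  show "- u + u = 0"
    by transfer (auto simp: sq_integrable_zero)
  show "u - v = u + - v"
    by transfer (auto intro: sq_integrable_diff)
  show "a *\<^sub>R (u + v) = a *\<^sub>R u + a *\<^sub>R v"
    by transfer (auto intro: sq_integrable_add sq_integrable_scale simp: distrib_left)
  show "(a + b) *\<^sub>R u = a *\<^sub>R u + b *\<^sub>R u"
    by transfer (auto intro: sq_integrable_add sq_integrable_scale simp: distrib_right)
  show "a *\<^sub>R b *\<^sub>R u = (a * b) *\<^sub>R u"
    by transfer (auto intro: sq_integrable_scale simp: mult.assoc)
  show "1 *\<^sub>R u = u"
    by transfer auto
qed

end

instantiation L2 :: (euclidean_space) real_inner
begin

lift_definition inner_L2 :: "'a L2 \<Rightarrow> 'a L2 \<Rightarrow> real" is "\<lambda>u v. \<integral>x. u x * v x \<partial>lebesgue"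
proof -
  fix u u' v v' :: "'a \<Rightarrow> real"
  assume *: "sq_integrable u \<and> sq_integrable u' \<and> (AE x in lebesgue. u x = u' x)"
    "sq_integrable v \<and> sq_integrable v' \<and> (AE x in lebesgue. v x = v' x)"
  show "(\<integral>x. u x * v x \<partial>lebesgue) = (\<integral>x. u' x * v' x \<partial>lebesgue)"
  proof (rule integral_cong_AE)
    show "(\<lambda>x. u x * v x) \<in> borel_measurable lebesgue"
      "(\<lambda>x. u' x * v' x) \<in> borel_measurable lebesgue"
      using * by (auto simp: sq_integrable_def)
    show "AE x in lebesgue. u x * v x = u' x * v' x"
      using * by (auto elim: AE_mp)
  qed
qed

definition norm_L2 :: "'a L2 \<Rightarrow> real" where "norm_L2 u = sqrt (inner u u)"
definition sgn_L2 :: "'a L2 \<Rightarrow> 'a L2" where "sgn_L2 u = u /\<^sub>R norm u"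
definition dist_L2 :: "'a L2 \<Rightarrow> 'a L2 \<Rightarrow> real" where "dist_L2 u v = norm (u - v)"
definition uniformity_L2 :: "('a L2 \<times> 'a L2) filter" where
  "uniformity_L2 = (INF e\<in>{0<..}. principal {(u, v). dist u v < e})"
definition open_L2 :: "'a L2 set \<Rightarrow> bool" where
  "open_L2 S = (\<forall>u\<in>S. \<forall>\<^sub>F (u', v) in uniformity. u' = u \<longrightarrow> v \<in> S)"

instance
proof
  fix a :: real and u v w :: "'a L2"
  show "inner u v = inner v u"
    by transfer (simp add: mult.commute)
  show "inner (u + v) w = inner u w + inner v w"
    by transfer (auto simp: distrib_right sq_integrable_times)
  show "inner (a *\<^sub>R u) v = a * inner u v"
    by transfer (simp add: mult.assoc)
  show "0 \<le> inner u u"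
    by transfer simp
  show "inner u u = 0 \<longleftrightarrow> u = 0"
    by transfer (auto simp: sq_integrable_zero integral_nonneg_eq_0_iff_AE sq_integrable_times)
qed (simp_all only: norm_L2_def sgn_L2_def dist_L2_def uniformity_L2_def open_L2_def)

end

text \<open>
  \<open>L\<^sup>2(\<Omega>)\<close> is identified, through extension by zero, with the subspace of those elements of
  \<open>L\<^sup>2\<close> of the whole space that vanish almost everywhere outside \<open>\<Omega>\<close>; the inner product and the
  norm are the same.
\<close>

lift_definition vanishes_outside :: "'a::euclidean_space set \<Rightarrow> 'a L2 \<Rightarrow> bool"
  is "\<lambda>\<Omega> u. AE x in lebesgue. x \<notin> \<Omega> \<longrightarrow> u x = 0"
proof -
  fix \<Omega> :: "'a set" and u u' :: "'a \<Rightarrow> real"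
  assume "sq_integrable u \<and> sq_integrable u' \<and> (AE x in lebesgue. u x = u' x)"
  then have "AE x in lebesgue. u x = u' x" by simp
  then show "(AE x in lebesgue. x \<notin> \<Omega> \<longrightarrow> u x = 0) = (AE x in lebesgue. x \<notin> \<Omega> \<longrightarrow> u' x = 0)"
    by (auto elim: AE_mp)
qed

definition L2_on :: "'a::euclidean_space set \<Rightarrow> 'a L2 set" where
  "L2_on \<Omega> = {u. vanishes_outside \<Omega> u}"

text \<open>
  \<open>L\<^sup>2\<close> is separable, so Borel measurability below is strong measurability.
\<close>

definition L2_time :: "real \<Rightarrow> 'a::euclidean_space set \<Rightarrow> (real \<Rightarrow> 'a L2) \<Rightarrow> bool" where
  "L2_time T \<Omega> f \<longleftrightarrow>
     (\<forall>t\<in>{0..T}. f t \<in> L2_on \<Omega>) \<and>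
     f \<in> borel_measurable (lebesgue_on {0<..<T}) \<and>
     integrable (lebesgue_on {0<..<T}) (\<lambda>t. (norm (f t))\<^sup>2)"


section \<open>Lipschitz domains and elliptic operators\<close>

text \<open>
  Near every boundary point the domain is the strict epigraph, in some direction \<open>e\<close>, of a
  Lipschitz function on the hyperplane orthogonal to \<open>e\<close>.
\<close>

definition lipschitz_domain :: "'a::euclidean_space set \<Rightarrow> bool" where
  "lipschitz_domain \<Omega> \<longleftrightarrow> open \<Omega> \<and> connected \<Omega> \<and> \<Omega> \<noteq> {} \<and>
     (\<forall>z\<in>frontier \<Omega>. \<exists>V e h L. open V \<and> z \<in> V \<and> norm e = 1 \<and>
        L-lipschitz_on {y. y \<bullet> e = 0} h \<and>
        \<Omega> \<inter> V = {x \<in> V. h (x - (x \<bullet> e) *\<^sub>R e) < x \<bullet> e})"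

text \<open>
  Multi-indices are lists of coordinate directions; the length of the list is the order.
\<close>

primrec iter_deriv :: "'a::euclidean_space list \<Rightarrow> ('a \<Rightarrow> real) \<Rightarrow> 'a \<Rightarrow> real" where
  "iter_deriv [] \<psi> = \<psi>"
| "iter_deriv (b # bs) \<psi> = (\<lambda>x. frechet_derivative (iter_deriv bs \<psi>) (at x) b)"

definition multi_indices :: "nat \<Rightarrow> 'a::euclidean_space list set" where
  "multi_indices n = {bs. set bs \<subseteq> Basis \<and> length bs = n}"

definition test_function :: "'a::euclidean_space set \<Rightarrow> ('a \<Rightarrow> real) \<Rightarrow> bool" where
  "test_function \<Omega> \<psi> \<longleftrightarrow>
     (\<forall>bs. set bs \<subseteq> Basis \<longrightarrow> (\<forall>x. iter_deriv bs \<psi> differentiable (at x))) \<and>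
     compact (closure {x. \<psi> x \<noteq> 0}) \<and> closure {x. \<psi> x \<noteq> 0} \<subseteq> \<Omega>"

definition locally_integrable :: "'a::euclidean_space set \<Rightarrow> ('a \<Rightarrow> real) \<Rightarrow> bool" where
  "locally_integrable \<Omega> w \<longleftrightarrow> (\<forall>K. compact K \<and> K \<subseteq> \<Omega> \<longrightarrow> set_integrable lebesgue K w)"

definition weak_deriv ::
    "'a::euclidean_space set \<Rightarrow> 'a list \<Rightarrow> ('a \<Rightarrow> real) \<Rightarrow> ('a \<Rightarrow> real) \<Rightarrow> bool" where
  "weak_deriv \<Omega> bs u w \<longleftrightarrow> locally_integrable \<Omega> w \<and>
     (\<forall>\<psi>. test_function \<Omega> \<psi> \<longrightarrow>
        (\<integral>x. u x * iter_deriv bs \<psi> x \<partial>lebesgue) = (-1) ^ length bs * (\<integral>x. w x * \<psi> x \<partial>lebesgue))"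

text \<open>
  \<open>A\<close> acts, in the weak sense, as a linear differential operator in divergence form of some
  order \<open>2 * m\<close> with \<open>m \<ge> 1\<close>, with coefficients \<open>a \<alpha> \<beta>\<close> and nowhere vanishing principal symbol.
  Boundary conditions are encoded in the domain \<open>D\<close>.
\<close>

definition elliptic_operator ::
    "'a::euclidean_space set \<Rightarrow> 'a L2 set \<Rightarrow> ('a L2 \<Rightarrow> 'a L2) \<Rightarrow> bool" where
  "elliptic_operator \<Omega> D A \<longleftrightarrow> (\<exists>m\<ge>1. \<exists>a :: 'a list \<Rightarrow> 'a list \<Rightarrow> 'a \<Rightarrow> real.
     (\<forall>\<alpha> \<beta>. a \<alpha> \<beta> \<in> borel_measurable (lebesgue_on \<Omega>)) \<and>
     (AE x in lebesgue_on \<Omega>. \<forall>\<xi>. \<xi> \<noteq> 0 \<longrightarrow>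
        (\<Sum>\<alpha>\<in>multi_indices m. \<Sum>\<beta>\<in>multi_indices m.
           a \<alpha> \<beta> x * (\<Prod>b\<leftarrow>\<alpha> @ \<beta>. \<xi> \<bullet> b)) \<noteq> 0) \<and>
     (\<forall>u\<in>D. \<exists>w :: 'a list \<Rightarrow> 'a \<Rightarrow> real.
        (\<forall>\<beta>\<in>(\<Union>i\<le>m. multi_indices i). weak_deriv \<Omega> \<beta> (rep_L2 u) (w \<beta>)) \<and>
        (\<forall>\<alpha>\<in>(\<Union>i\<le>m. multi_indices i). \<forall>\<beta>\<in>(\<Union>i\<le>m. multi_indices i).
           locally_integrable \<Omega> (\<lambda>x. a \<alpha> \<beta> x * w \<beta> x)) \<and>
        (\<forall>\<psi>. test_function \<Omega> \<psi> \<longrightarrow>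
           (\<integral>x. rep_L2 (A u) x * \<psi> x \<partial>lebesgue) =
           (\<Sum>\<alpha>\<in>(\<Union>i\<le>m. multi_indices i). \<Sum>\<beta>\<in>(\<Union>i\<le>m. multi_indices i).
              \<integral>x. a \<alpha> \<beta> x * w \<beta> x * iter_deriv \<alpha> \<psi> x \<partial>lebesgue))))"


section \<open>Operators with an orthonormal eigenbasis\<close>

text \<open>
  A (possibly unbounded) operator in the Hilbert space \<open>H\<close> is given by its domain \<open>D\<close> and a
  function \<open>A\<close> that is relevant on \<open>D\<close> only.
\<close>

definition linear_operator :: "'h::real_inner set \<Rightarrow> 'h set \<Rightarrow> ('h \<Rightarrow> 'h) \<Rightarrow> bool" where
  "linear_operator H D A \<longleftrightarrow> subspace D \<and> D \<subseteq> H \<and> A ` D \<subseteq> H \<and>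
     (\<forall>u\<in>D. \<forall>v\<in>D. A (u + v) = A u + A v) \<and> (\<forall>a. \<forall>u\<in>D. A (a *\<^sub>R u) = a *\<^sub>R A u)"

text \<open>The left-hand side says that \<open>(v, w)\<close> lies in the graph of the adjoint.\<close>

definition self_adjoint :: "'h::real_inner set \<Rightarrow> 'h set \<Rightarrow> ('h \<Rightarrow> 'h) \<Rightarrow> bool" where
  "self_adjoint H D A \<longleftrightarrow>
     (\<forall>v\<in>H. \<forall>w\<in>H. (\<forall>u\<in>D. A u \<bullet> v = u \<bullet> w) \<longleftrightarrow> v \<in> D \<and> w = A v)"

definition positive_definite :: "'h::real_inner set \<Rightarrow> ('h \<Rightarrow> 'h) \<Rightarrow> bool" where
  "positive_definite D A \<longleftrightarrow> (\<forall>u\<in>D. u \<noteq> 0 \<longrightarrow> A u \<bullet> u > 0)"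

definition orthonormal_basis :: "'h::real_inner set \<Rightarrow> (nat \<Rightarrow> 'h) \<Rightarrow> bool" where
  "orthonormal_basis H \<phi> \<longleftrightarrow>
     (\<forall>i j. \<phi> i \<bullet> \<phi> j = (if i = j then 1 else 0)) \<and> closure (span (range \<phi>)) = H"

definition spectral_fun ::
    "(nat \<Rightarrow> real) \<Rightarrow> (nat \<Rightarrow> 'h::real_inner) \<Rightarrow> (real \<Rightarrow> real) \<Rightarrow> 'h \<Rightarrow> 'h" where
  "spectral_fun lam \<phi> g v = (\<Sum>p. (g (lam p) * (v \<bullet> \<phi> p)) *\<^sub>R \<phi> p)"

lemma spectral_fun_eigenvector:
  assumes "orthonormal_basis H \<phi>"
  shows "spectral_fun lam \<phi> g (\<phi> q) = g (lam q) *\<^sub>R \<phi> q"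
proof -
  have "(\<lambda>p. (g (lam p) * (\<phi> q \<bullet> \<phi> p)) *\<^sub>R \<phi> p) =
      (\<lambda>p. if p = q then g (lam p) *\<^sub>R \<phi> p else 0)"
    using assms by (auto simp: orthonormal_basis_def fun_eq_iff)
  then show ?thesis
    unfolding spectral_fun_def
    using sums_single[of q "\<lambda>p. g (lam p) *\<^sub>R \<phi> p"] by (simp add: sums_iff)
qed

definition spectral_bounded ::
    "'h::real_inner set \<Rightarrow> (nat \<Rightarrow> real) \<Rightarrow> (nat \<Rightarrow> 'h) \<Rightarrow> (real \<Rightarrow> real) \<Rightarrow> bool" where
  "spectral_bounded H lam \<phi> g \<longleftrightarrow> (\<exists>C. \<forall>v\<in>H.
     summable (\<lambda>p. (g (lam p) * (v \<bullet> \<phi> p)) *\<^sub>R \<phi> p) \<and>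
     norm (spectral_fun lam \<phi> g v) \<le> C * norm v)"

definition rational_no_poles :: "(real \<Rightarrow> real) \<Rightarrow> bool" where
  "rational_no_poles g \<longleftrightarrow>
     (\<exists>p q :: real poly. \<forall>s\<ge>0. poly q s \<noteq> 0 \<and> g s = poly p s / poly q s)"


section \<open>Propagators\<close>

text \<open>
  In this section \<open>S g\<close> stands for the operator \<open>g(A)\<close>, and \<open>f\<close> is the source term.
\<close>

definition single_step ::
    "((real \<Rightarrow> real) \<Rightarrow> 'h::real_vector \<Rightarrow> 'h) \<Rightarrow> (real \<Rightarrow> 'h) \<Rightarrow> (real \<Rightarrow> real) \<Rightarrow>
     nat \<Rightarrow> (nat \<Rightarrow> real \<Rightarrow> real) \<Rightarrow> (nat \<Rightarrow> real) \<Rightarrow> real \<Rightarrow> real \<Rightarrow> 'h \<Rightarrow> 'h" where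
  "single_step S f r m p c t \<tau> v =
     S (\<lambda>s. r (\<tau> * s)) v + \<tau> *\<^sub>R (\<Sum>i=1..m. S (\<lambda>s. p i (\<tau> * s)) (f (t + c i * \<tau>)))"

definition R1 :: "(nat \<Rightarrow> real) \<Rightarrow> (nat \<Rightarrow> real) \<Rightarrow> real \<Rightarrow> real" where
  "R1 \<alpha> \<beta> s = (- \<alpha> 0 - \<beta> 0 * s) / (\<alpha> 2 + \<beta> 2 * s)"

definition R2 :: "(nat \<Rightarrow> real) \<Rightarrow> (nat \<Rightarrow> real) \<Rightarrow> real \<Rightarrow> real" where
  "R2 \<alpha> \<beta> s = (- \<alpha> 1 - \<beta> 1 * s) / (\<alpha> 2 + \<beta> 2 * s)"

definition two_step ::
    "((real \<Rightarrow> real) \<Rightarrow> 'h::real_vector \<Rightarrow> 'h) \<Rightarrow> (real \<Rightarrow> 'h) \<Rightarrow> (nat \<Rightarrow> real) \<Rightarrow> (nat \<Rightarrow> real) \<Rightarrow>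
     real \<Rightarrow> real \<Rightarrow> 'h \<Rightarrow> 'h \<Rightarrow> 'h" where
  "two_step S f \<alpha> \<beta> t \<tau> v1 v2 =
     S (\<lambda>s. R1 \<alpha> \<beta> (\<tau> * s)) v1 + S (\<lambda>s. R2 \<alpha> \<beta> (\<tau> * s)) v2 +
     \<tau> *\<^sub>R S (\<lambda>s. 1 / (\<alpha> 2 + \<beta> 2 * (\<tau> * s))) (\<Sum>i\<le>2. \<beta> i *\<^sub>R f (t + (real i - 1) * \<tau>))"

definition two_step_order :: "(nat \<Rightarrow> real) \<Rightarrow> (nat \<Rightarrow> real) \<Rightarrow> nat \<Rightarrow> bool" where
  "two_step_order \<alpha> \<beta> q \<longleftrightarrow> (\<Sum>i\<le>2. \<alpha> i) = 0 \<and>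
     (\<forall>p\<in>{1..q}. (\<Sum>i\<le>2. \<alpha> i * real i ^ p) = real p * (\<Sum>i\<le>2. \<beta> i * real i ^ (p - 1)))"

primrec iterate_step ::
    "(real \<Rightarrow> real \<Rightarrow> 'h \<Rightarrow> 'h) \<Rightarrow> real \<Rightarrow> real \<Rightarrow> 'h \<Rightarrow> nat \<Rightarrow> 'h" where
  "iterate_step F dt t v 0 = v"
| "iterate_step F dt t v (Suc j) = F (t + real j * dt) dt (iterate_step F dt t v j)"


section \<open>The two-step parareal algorithm\<close>

text \<open>
  Half-integer grid indices are doubled: index \<open>m\<close> refers to the time \<open>m * \<tau>\<close>, where \<open>\<tau>\<close> is half
  the coarse step. \<open>Fh\<close> and \<open>Ff\<close> are the fine propagators (arguments: starting time, initial
  value) over half a coarse step and over a full coarse step, \<open>G\<close> and \<open>G2\<close> are the single-step and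
  the two-step coarse propagators.
\<close>

primrec fine_solution_int :: "(real \<Rightarrow> 'h \<Rightarrow> 'h) \<Rightarrow> real \<Rightarrow> 'h \<Rightarrow> nat \<Rightarrow> 'h" where
  "fine_solution_int Ff \<tau> u0 0 = u0"
| "fine_solution_int Ff \<tau> u0 (Suc n) = Ff (real n * (2 * \<tau>)) (fine_solution_int Ff \<tau> u0 n)"

definition fine_solution ::
    "(real \<Rightarrow> 'h \<Rightarrow> 'h) \<Rightarrow> (real \<Rightarrow> 'h \<Rightarrow> 'h) \<Rightarrow> real \<Rightarrow> 'h \<Rightarrow> nat \<Rightarrow> 'h" where
  "fine_solution Fh Ff \<tau> u0 m =
     (let n = m div 2; U = fine_solution_int Ff \<tau> u0 n
      in if even m then U else Fh (real n * (2 * \<tau>)) U)"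

fun coarse_init ::
    "(real \<Rightarrow> real \<Rightarrow> 'h \<Rightarrow> 'h) \<Rightarrow> (real \<Rightarrow> real \<Rightarrow> 'h \<Rightarrow> 'h \<Rightarrow> 'h) \<Rightarrow> real \<Rightarrow> 'h \<Rightarrow> nat \<Rightarrow> 'h" where
  "coarse_init G G2 \<tau> u0 0 = u0"
| "coarse_init G G2 \<tau> u0 (Suc 0) = G 0 \<tau> u0"
| "coarse_init G G2 \<tau> u0 (Suc (Suc m)) =
     G2 (real (m + 1) * \<tau>) \<tau> (coarse_init G G2 \<tau> u0 m) (coarse_init G G2 \<tau> u0 (Suc m))"

definition parareal_init ::
    "(real \<Rightarrow> 'h \<Rightarrow> 'h) \<Rightarrow> (real \<Rightarrow> 'h \<Rightarrow> 'h) \<Rightarrow> (real \<Rightarrow> real \<Rightarrow> 'h \<Rightarrow> 'h) \<Rightarrow>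
     (real \<Rightarrow> real \<Rightarrow> 'h \<Rightarrow> 'h \<Rightarrow> 'h) \<Rightarrow> real \<Rightarrow> 'h \<Rightarrow> nat \<Rightarrow> 'h" where
  "parareal_init Fh Ff G G2 \<tau> u0 m =
     (if m = 1 then Fh 0 u0 else if m = 2 then Ff 0 u0 else coarse_init G G2 \<tau> u0 m)"

text \<open>
  One sweep: \<open>V\<close> is the initial iterate and \<open>W\<close> the previous one.
\<close>

fun parareal_sweep ::
    "(real \<Rightarrow> 'h \<Rightarrow> 'h) \<Rightarrow> (real \<Rightarrow> 'h \<Rightarrow> 'h) \<Rightarrow> (real \<Rightarrow> real \<Rightarrow> 'h::real_vector \<Rightarrow> 'h \<Rightarrow> 'h) \<Rightarrow>
     real \<Rightarrow> 'h \<Rightarrow> (nat \<Rightarrow> 'h) \<Rightarrow> (nat \<Rightarrow> 'h) \<Rightarrow> nat \<Rightarrow> 'h" where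
  "parareal_sweep Fh Ff G2 \<tau> u0 V W 0 = u0"
| "parareal_sweep Fh Ff G2 \<tau> u0 V W (Suc 0) = V 1"
| "parareal_sweep Fh Ff G2 \<tau> u0 V W (Suc (Suc 0)) = V 2"
| "parareal_sweep Fh Ff G2 \<tau> u0 V W (Suc (Suc (Suc n))) =
     (let m = Suc n; t = real (m + 1) * \<tau> in
        G2 t \<tau> (parareal_sweep Fh Ff G2 \<tau> u0 V W (Suc n))
               (parareal_sweep Fh Ff G2 \<tau> u0 V W (Suc (Suc n)))
        + Ff (real m * \<tau>) (W m)
        - G2 t \<tau> (W m) (Fh (real m * \<tau>) (W m)))"

primrec parareal ::
    "(real \<Rightarrow> 'h \<Rightarrow> 'h) \<Rightarrow> (real \<Rightarrow> 'h \<Rightarrow> 'h) \<Rightarrow> (real \<Rightarrow> real \<Rightarrow> 'h \<Rightarrow> 'h) \<Rightarrow>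
     (real \<Rightarrow> real \<Rightarrow> 'h::real_vector \<Rightarrow> 'h \<Rightarrow> 'h) \<Rightarrow> real \<Rightarrow> 'h \<Rightarrow> nat \<Rightarrow> nat \<Rightarrow> 'h" where
  "parareal Fh Ff G G2 \<tau> u0 0 = parareal_init Fh Ff G G2 \<tau> u0"
| "parareal Fh Ff G G2 \<tau> u0 (Suc k) =
     parareal_sweep Fh Ff G2 \<tau> u0 (parareal_init Fh Ff G G2 \<tau> u0) (parareal Fh Ff G G2 \<tau> u0 k)"

text \<open>
  The supremum may be infinite, hence an extended real. It does not depend on how the two roots
  \<open>\<rho>1 s\<close> and \<open>\<rho>2 s\<close> are labelled.
\<close>

definition conv_factor ::
    "(real \<Rightarrow> real) \<Rightarrow> (real \<Rightarrow> real) \<Rightarrow> (real \<Rightarrow> real) \<Rightarrow> nat \<Rightarrow>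
     (real \<Rightarrow> complex) \<Rightarrow> (real \<Rightarrow> complex) \<Rightarrow> ereal" where
  "conv_factor r Ra Rb J \<rho>1 \<rho>2 = (SUP s\<in>{0<..}. ereal
     (\<bar>r (2 * s / real J) ^ J - Rb s * r (2 * s / real J) ^ (J div 2) - Ra s\<bar> /
      ((1 - cmod (\<rho>1 s)) * (1 - cmod (\<rho>2 s)))))"

end

theory Submission
  imports Defs
begin

text \<open>
  In the eigenbasis of \<open>A\<close> every propagator is affine with a scalar linear part, and the fine
  solution is a fixed point of the sweep. So each coefficient of the error satisfies
  \<open>e' (m + 2) = R2 s * e' (m + 1) + R1 s * e' m + (r ^ J - R2 s * r ^ (J / 2) - R1 s) * e m\<close>
  at \<open>s = \<tau> * \<lambda>\<close>, where \<open>e\<close> belongs to the previous and \<open>e'\<close> to the new iterate, and \<open>e'\<close>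
  vanishes for the first indices. Factoring the recurrence into two one-step recurrences with
  ratios \<open>\<rho>1 s\<close> and \<open>\<rho>2 s\<close> shows that the maximum over \<open>m\<close> contracts by the convergence factor, for
  every coefficient separately; Parseval's identity adds up the coefficients.
\<close>

section \<open>Expansions in an orthonormal basis\<close>

lemma subspace_closure:
  fixes X :: "'h::real_normed_vector set"
  assumes "subspace X"
  shows "subspace (closure X)"
proof (rule subspaceI)
  show "0 \<in> closure X"
    using subspace_0[OF assms] closure_subset by blast
next
  fix x y assume "x \<in> closure X" "y \<in> closure X"
  then obtain a b where "\<And>n. a n \<in> X" "a \<longlonglongrightarrow> x" "\<And>n. b n \<in> X" "b \<longlonglongrightarrow> y"
    unfolding closure_sequential by blast
  then show "x + y \<in> closure X"
    unfolding closure_sequential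
    by (intro exI[of _ "\<lambda>n. a n + b n"]) (auto intro: tendsto_add subspace_add[OF assms])
next
  fix c x assume "x \<in> closure X"
  then obtain a where "\<And>n. a n \<in> X" "a \<longlonglongrightarrow> x"
    unfolding closure_sequential by blast
  then show "c *\<^sub>R x \<in> closure X"
    unfolding closure_sequential
    by (intro exI[of _ "\<lambda>n. c *\<^sub>R a n"])
      (auto intro: tendsto_scaleR subspace_scale[OF assms])
qed

lemma orthonormal_basis_subspace:
  assumes "orthonormal_basis H \<phi>"
  shows "subspace H"
  using assms by (auto simp: orthonormal_basis_def intro: subspace_closure subspace_span)

lemma orthonormal_basis_closed:
  assumes "orthonormal_basis H \<phi>"
  shows "closed H"
  using assms by (auto simp: orthonormal_basis_def)

lemma orthonormal_basis_mem:
  assumes "orthonormal_basis H \<phi>"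
  shows "\<phi> i \<in> H"
proof -
  have "\<phi> i \<in> span (range \<phi>)"
    by (simp add: span_base)
  then show ?thesis
    using assms closure_subset[of "span (range \<phi>)"] by (auto simp: orthonormal_basis_def)
qed

text \<open>The spans of initial segments form an increasing chain, so their union is a subspace,
  and it contains every \<open>\<phi> i\<close>.\<close>

lemma span_range_nat_obtain_finite:
  fixes \<phi> :: "nat \<Rightarrow> 'h::real_vector"
  assumes "w \<in> span (range \<phi>)"
  obtains N where "w \<in> span (\<phi> ` {..<N})"
proof -
  have mono: "span (\<phi> ` {..<N}) \<subseteq> span (\<phi> ` {..<N'})" if "N \<le> N'" for N N'
    using that by (intro span_mono image_mono) auto
  have "subspace {w. \<exists>N. w \<in> span (\<phi> ` {..<N})}"
    unfolding subspace_def
  proof (safe, goal_cases)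
    case 1
    then show ?case by (auto intro: span_zero)
  next
    case (2 x y N N')
    then have "x + y \<in> span (\<phi> ` {..<max N N'})"
      using mono[of N "max N N'"] mono[of N' "max N N'"] by (intro span_add) auto
    then show ?case ..
  next
    case (3 c x N)
    then show ?case by (auto intro: span_scale)
  qed
  moreover have "\<exists>N. \<phi> i \<in> span (\<phi> ` {..<N})" for i
    by (rule exI[of _ "Suc i"]) (simp add: span_base)
  ultimately have "span (range \<phi>) \<subseteq> {w. \<exists>N. w \<in> span (\<phi> ` {..<N})}"
    by (intro span_minimal) auto
  with assms that show thesis by auto
qed

text \<open>The partial sum \<open>Q n\<close> is the orthogonal projection of \<open>v\<close> onto
  the span of the first \<open>n\<close> basis vectors. By Pythagoras the claim amounts to
  \<open>v - Q n\<close> tending to 0, which follows from best approximation and the density of the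
  span in \<open>H\<close>.\<close>

lemma parseval:
  assumes onb: "orthonormal_basis H \<phi>" and "v \<in> H"
  shows "(\<lambda>i. (v \<bullet> \<phi> i)\<^sup>2) sums (norm v)\<^sup>2"
proof -
  define Q where "Q n = (\<Sum>i<n. (v \<bullet> \<phi> i) *\<^sub>R \<phi> i)" for n
  have on: "\<phi> i \<bullet> \<phi> j = (if i = j then 1 else 0)" for i j
    using onb by (simp add: orthonormal_basis_def)
  have orth: "(v - Q n) \<bullet> \<phi> i = 0" if "i < n" for i n
    using that by (simp add: Q_def inner_diff_left inner_sum_left on if_distrib
        [of "\<lambda>x. a * x" for a] cong: if_cong)
  have orth_span: "(v - Q n) \<bullet> w = 0" if "w \<in> span (\<phi> ` {..<n})" for w n
    using orthogonal_to_span[OF that, of "v - Q n"] orth by (auto simp: orthogonal_def)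
  have Q_span: "Q n \<in> span (\<phi> ` {..<n})" for n
    unfolding Q_def by (intro span_sum span_scale span_base) auto
  have vQ: "v \<bullet> Q n = (\<Sum>i<n. (v \<bullet> \<phi> i)\<^sup>2)" for n
    by (simp add: Q_def inner_sum_right power2_eq_square)
  have diff: "(norm v)\<^sup>2 - (\<Sum>i<n. (v \<bullet> \<phi> i)\<^sup>2) = (norm (v - Q n))\<^sup>2" for n
    using orth_span[OF Q_span, of n] vQ[of n]
    by (simp add: power2_norm_eq_inner inner_diff_left inner_diff_right inner_commute)
  have best: "norm (v - Q n) \<le> norm (v - w)" if "w \<in> span (\<phi> ` {..<n})" for w n
  proof -
    have "(norm (v - Q n))\<^sup>2 = (v - Q n) \<bullet> (v - w)"
      using orth_span[OF Q_span, of n] orth_span[OF that]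
      by (simp add: power2_norm_eq_inner inner_diff_right)
    also have "\<dots> \<le> norm (v - Q n) * norm (v - w)"
      by (rule norm_cauchy_schwarz)
    finally show ?thesis
      by (cases "v = Q n") (auto simp: power2_eq_square)
  qed
  have "(\<lambda>n. norm (v - Q n)) \<longlonglongrightarrow> 0"
  proof (rule LIMSEQ_I)
    fix e :: real assume "0 < e"
    from \<open>v \<in> H\<close> onb have "v \<in> closure (span (range \<phi>))"
      by (simp add: orthonormal_basis_def)
    with \<open>0 < e\<close> obtain w where w: "w \<in> span (range \<phi>)" "dist w v < e"
      unfolding closure_approachable by blast
    then obtain N where N: "w \<in> span (\<phi> ` {..<N})"
      using span_range_nat_obtain_finite by blast
    have "norm (v - Q n) < e" if "N \<le> n" for n
    proof -
      have "w \<in> span (\<phi> ` {..<n})"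
        using N that span_mono[of "\<phi> ` {..<N}" "\<phi> ` {..<n}"] by force
      then show ?thesis
        using best[of w n] w(2) by (simp add: dist_norm norm_minus_commute)
    qed
    then show "\<exists>N. \<forall>n\<ge>N. norm (norm (v - Q n) - 0) < e"
      by auto
  qed
  then have "(\<lambda>n. (norm v)\<^sup>2 - (norm (v - Q n))\<^sup>2) \<longlonglongrightarrow> (norm v)\<^sup>2 - 0\<^sup>2"
    by (intro tendsto_intros)
  then show ?thesis
    by (simp add: sums_def flip: diff)
qed

text \<open>Parseval's identity is applied on both sides. The comparison is with a finite family
  \<open>w\<close>, so that a coefficient of a later error can be bounded by those of all initial
  errors together.\<close>

lemma norm_le_by_coefficients:
  assumes onb: "orthonormal_basis H \<phi>" and "v \<in> H" and "\<And>i. i \<in> I \<Longrightarrow> w i \<in> H"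
    and le: "\<And>n. (v \<bullet> \<phi> n)\<^sup>2 \<le> K\<^sup>2 * (\<Sum>i\<in>I. (w i \<bullet> \<phi> n)\<^sup>2)" and "0 \<le> K"
  shows "norm v \<le> K * sqrt (\<Sum>i\<in>I. (norm (w i))\<^sup>2)"
proof -
  have "(\<lambda>n. K\<^sup>2 * (\<Sum>i\<in>I. (w i \<bullet> \<phi> n)\<^sup>2)) sums (K\<^sup>2 * (\<Sum>i\<in>I. (norm (w i))\<^sup>2))"
    using assms by (intro sums_mult sums_sum parseval[OF onb])
  from sums_le[OF le parseval[OF onb \<open>v \<in> H\<close>] this]
  have "(norm v)\<^sup>2 \<le> (K * sqrt (\<Sum>i\<in>I. (norm (w i))\<^sup>2))\<^sup>2"
    by (simp add: power_mult_distrib sum_nonneg)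
  then show ?thesis
    by (rule power2_le_imp_le) (simp add: \<open>0 \<le> K\<close> sum_nonneg)
qed

lemma spectral_fun_mem:
  assumes onb: "orthonormal_basis H \<phi>" and sb: "spectral_bounded H lam \<phi> g" and v: "v \<in> H"
  shows "spectral_fun lam \<phi> g v \<in> H"
proof (rule Lim_in_closed_set[OF orthonormal_basis_closed[OF onb] _ sequentially_bot])
  show "(\<lambda>n. \<Sum>i<n. (g (lam i) * (v \<bullet> \<phi> i)) *\<^sub>R \<phi> i) \<longlonglongrightarrow> spectral_fun lam \<phi> g v"
    using sb v unfolding spectral_bounded_def spectral_fun_def
    by (auto intro: summable_LIMSEQ)
  show "\<forall>\<^sub>F n in sequentially. (\<Sum>i<n. (g (lam i) * (v \<bullet> \<phi> i)) *\<^sub>R \<phi> i) \<in> H"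
    using orthonormal_basis_subspace[OF onb] orthonormal_basis_mem[OF onb]
    by (intro always_eventually allI subspace_sum subspace_scale)
qed

text \<open>\<open>spectral_bounded\<close> makes the series converge, so the inner product may be
  taken term by term, and orthonormality leaves one term.\<close>

lemma inner_spectral_fun:
  assumes onb: "orthonormal_basis H \<phi>" and sb: "spectral_bounded H lam \<phi> g" and v: "v \<in> H"
  shows "spectral_fun lam \<phi> g v \<bullet> \<phi> n = g (lam n) * (v \<bullet> \<phi> n)"
proof -
  have "(\<lambda>i. (g (lam i) * (v \<bullet> \<phi> i)) *\<^sub>R \<phi> i) sums spectral_fun lam \<phi> g v"
    using sb v unfolding spectral_bounded_def spectral_fun_def by (auto intro: summable_sums)
  from bounded_linear.sums[OF bounded_linear_inner_left this, of "\<phi> n"]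
  have "(\<lambda>i. (g (lam i) * (v \<bullet> \<phi> i)) * (\<phi> i \<bullet> \<phi> n)) sums (spectral_fun lam \<phi> g v \<bullet> \<phi> n)"
    by simp
  moreover have "(\<lambda>i. (g (lam i) * (v \<bullet> \<phi> i)) * (\<phi> i \<bullet> \<phi> n)) =
      (\<lambda>i. if i = n then g (lam n) * (v \<bullet> \<phi> n) else 0)"
    using onb by (auto simp: orthonormal_basis_def)
  ultimately show ?thesis
    using sums_single[of n "\<lambda>i. g (lam n) * (v \<bullet> \<phi> n)"] by (auto intro: sums_unique2)
qed

section \<open>Two-step recurrences\<close>

text \<open>The bound is the solution of \<open>b = B + cmod \<rho> * b\<close>, so each step of the
  recurrence preserves it.\<close>

lemma one_step_recurrence_bound:
  fixes y :: "nat \<Rightarrow> complex"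
  assumes "cmod \<rho> < 1" "0 \<le> B" "y 0 = 0"
    and "\<And>n. n < N \<Longrightarrow> cmod (y (Suc n) - \<rho> * y n) \<le> B"
    and "n \<le> N"
  shows "cmod (y n) \<le> B / (1 - cmod \<rho>)"
  using \<open>n \<le> N\<close>
proof (induction n)
  case 0
  then show ?case using assms by simp
next
  case (Suc n)
  have "cmod (y (Suc n)) = cmod ((y (Suc n) - \<rho> * y n) + \<rho> * y n)"
    by simp
  also have "\<dots> \<le> cmod (y (Suc n) - \<rho> * y n) + cmod \<rho> * cmod (y n)"
    by (metis norm_mult norm_triangle_ineq)
  also have "\<dots> \<le> B + cmod \<rho> * (B / (1 - cmod \<rho>))"
    using Suc assms by (intro add_mono mult_left_mono) auto
  also have "\<dots> = B / (1 - cmod \<rho>)"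
    using assms by (simp add: field_simps)
  finally show ?case .
qed

text \<open>The characteristic polynomial factors, so that \<open>x (n + 1) - \<rho>1 * x n\<close> obeys a one-step
  recurrence with ratio \<open>\<rho>2\<close>.\<close>

lemma two_step_recurrence_bound:
  fixes x :: "nat \<Rightarrow> real"
  assumes sum: "\<rho>1 + \<rho>2 = complex_of_real b" and prod: "\<rho>1 * \<rho>2 = complex_of_real (- a)"
    and \<rho>1: "cmod \<rho>1 < 1" and \<rho>2: "cmod \<rho>2 < 1" and "0 \<le> B"
    and "x 0 = 0" "x 1 = 0"
    and step: "\<And>n. n + 2 \<le> N \<Longrightarrow> \<bar>x (n + 2) - b * x (n + 1) - a * x n\<bar> \<le> B"
    and "n \<le> N"
  shows "\<bar>x n\<bar> \<le> B / ((1 - cmod \<rho>1) * (1 - cmod \<rho>2))"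
proof -
  define y where "y n = complex_of_real (x (Suc n)) - \<rho>1 * x n" for n
  have "y (Suc n) - \<rho>2 * y n = complex_of_real (x (n + 2) - b * x (n + 1) - a * x n)" for n
  proof -
    have "y (Suc n) - \<rho>2 * y n =
        x (n + 2) - (\<rho>1 + \<rho>2) * x (n + 1) + (\<rho>1 * \<rho>2) * x n"
      by (simp add: y_def algebra_simps)
    then show ?thesis
      unfolding sum prod by simp
  qed
  \<comment> \<open>Since \<open>y n\<close> involves \<open>x (n + 1)\<close>, its range ends one
    step earlier, at \<open>N - 1\<close>.\<close>
  then have "cmod (y (Suc n) - \<rho>2 * y n) \<le> B" if "n < N - 1" for n
    using step[of n] that by (simp only: norm_of_real)
  then have "cmod (y n) \<le> B / (1 - cmod \<rho>2)" if "n \<le> N - 1" for n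
    using that assms by (intro one_step_recurrence_bound[of \<rho>2 B y "N - 1"]) (auto simp: y_def)
  \<comment> \<open>Now \<open>y\<close> is the inhomogeneity of a one-step recurrence for
    \<open>x\<close> itself, with ratio \<open>\<rho>1\<close>; this contributes the second
    denominator.\<close>
  with assms have "cmod (complex_of_real (x n)) \<le> B / (1 - cmod \<rho>2) / (1 - cmod \<rho>1)"
    by (intro one_step_recurrence_bound[of \<rho>1 _ "\<lambda>n. of_real (x n)" N])
      (auto simp flip: y_def)
  then show ?thesis
    by (simp add: mult.commute)
qed

section \<open>Propagators in spectral coordinates\<close>

lemma single_step_mem:
  assumes onb: "orthonormal_basis H \<phi>"
    and "spectral_bounded H lam \<phi> (\<lambda>s. r (\<tau> * s))"
    and "\<And>i. i \<in> {1..m} \<Longrightarrow> spectral_bounded H lam \<phi> (\<lambda>s. p i (\<tau> * s))"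
    and "\<And>i. i \<in> {1..m} \<Longrightarrow> f (t + c i * \<tau>) \<in> H" and "v \<in> H"
  shows "single_step (spectral_fun lam \<phi>) f r m p c t \<tau> v \<in> H"
  unfolding single_step_def using assms
  by (intro subspace_add subspace_scale subspace_sum orthonormal_basis_subspace[OF onb]
      spectral_fun_mem)

text \<open>The source terms do not depend on the initial value and cancel in the difference, which
  leaves only the multiplier.\<close>

lemma inner_single_step_diff:
  assumes onb: "orthonormal_basis H \<phi>" and sb: "spectral_bounded H lam \<phi> (\<lambda>s. r (\<tau> * s))"
    and "v \<in> H" "w \<in> H"
  shows "(single_step (spectral_fun lam \<phi>) f r m p c t \<tau> v -
      single_step (spectral_fun lam \<phi>) f r m p c t \<tau> w) \<bullet> \<phi> n
    = r (\<tau> * lam n) * ((v - w) \<bullet> \<phi> n)"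
  using assms
  by (simp add: single_step_def inner_diff_left inner_spectral_fun[OF onb sb];
      simp add: algebra_simps)

lemma two_step_mem:
  assumes onb: "orthonormal_basis H \<phi>"
    and "spectral_bounded H lam \<phi> (\<lambda>s. R1 \<alpha> \<beta> (\<tau> * s))"
    and "spectral_bounded H lam \<phi> (\<lambda>s. R2 \<alpha> \<beta> (\<tau> * s))"
    and "spectral_bounded H lam \<phi> (\<lambda>s. 1 / (\<alpha> 2 + \<beta> 2 * (\<tau> * s)))"
    and "\<And>i. i \<le> 2 \<Longrightarrow> f (t + (real i - 1) * \<tau>) \<in> H" and "v \<in> H" "w \<in> H"
  shows "two_step (spectral_fun lam \<phi>) f \<alpha> \<beta> t \<tau> v w \<in> H"
  unfolding two_step_def using assms
  by (intro subspace_add subspace_scale subspace_sum orthonormal_basis_subspace[OF onb]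
      spectral_fun_mem) auto

lemma inner_two_step_diff:
  assumes onb: "orthonormal_basis H \<phi>"
    and sb1: "spectral_bounded H lam \<phi> (\<lambda>s. R1 \<alpha> \<beta> (\<tau> * s))"
    and sb2: "spectral_bounded H lam \<phi> (\<lambda>s. R2 \<alpha> \<beta> (\<tau> * s))"
    and "v \<in> H" "w \<in> H" "v' \<in> H" "w' \<in> H"
  shows "(two_step (spectral_fun lam \<phi>) f \<alpha> \<beta> t \<tau> v w -
      two_step (spectral_fun lam \<phi>) f \<alpha> \<beta> t \<tau> v' w') \<bullet> \<phi> n
    = R1 \<alpha> \<beta> (\<tau> * lam n) * ((v - v') \<bullet> \<phi> n) + R2 \<alpha> \<beta> (\<tau> * lam n) * ((w - w') \<bullet> \<phi> n)"
  using assms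
  by (simp add: two_step_def inner_diff_left inner_add_left inner_spectral_fun[OF onb sb1]
      inner_spectral_fun[OF onb sb2]; simp add: algebra_simps)

lemma iterate_step_add:
  "iterate_step F dt t v (i + j) = iterate_step F dt (t + real i * dt) (iterate_step F dt t v i) j"
  by (induction j) (simp_all add: algebra_simps)

text \<open>All propagators act coefficient by coefficient, so the analysis takes place in an
  abstract inner product space with an orthonormal basis of \<open>H\<close>. The
  \<open>spectral_bounded\<close> assumptions let the coefficients of the spectral series be read
  off.\<close>

locale two_step_parareal =
  fixes H :: "'h::real_inner set" and lam :: "nat \<Rightarrow> real" and \<phi> :: "nat \<Rightarrow> 'h"
    and u0 :: 'h and f :: "real \<Rightarrow> 'h" and T dt :: real and J Nc :: nat
    and r :: "real \<Rightarrow> real" and m0 :: nat and p :: "nat \<Rightarrow> real \<Rightarrow> real" and c :: "nat \<Rightarrow> real"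
    and R :: "real \<Rightarrow> real" and M :: nat and P :: "nat \<Rightarrow> real \<Rightarrow> real" and C :: "nat \<Rightarrow> real"
    and \<alpha> \<beta> :: "nat \<Rightarrow> real" and \<tau> :: real
    and F G :: "real \<Rightarrow> real \<Rightarrow> 'h \<Rightarrow> 'h" and Fh Ff :: "real \<Rightarrow> 'h \<Rightarrow> 'h"
    and G2 :: "real \<Rightarrow> real \<Rightarrow> 'h \<Rightarrow> 'h \<Rightarrow> 'h"
  assumes \<tau>_def: "\<tau> = real J * dt / 2"
    and F_def: "F = single_step (spectral_fun lam \<phi>) f r m0 p c"
    and Fh_def: "Fh = (\<lambda>t v. iterate_step F dt t v (J div 2))"
    and Ff_def: "Ff = (\<lambda>t v. iterate_step F dt t v J)"
    and G_def: "G = single_step (spectral_fun lam \<phi>) f R M P C"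
    and G2_def: "G2 = two_step (spectral_fun lam \<phi>) f \<alpha> \<beta>"
    and onb: "orthonormal_basis H \<phi>"
    and u0_mem: "u0 \<in> H" and f_mem: "t \<in> {0..T} \<Longrightarrow> f t \<in> H"
    and J_pos: "J > 0" and J_even: "even J" and dt_pos: "dt > 0" and Nc_pos: "Nc > 0"
    and T_eq: "real Nc * (real J * dt) = T"
    and c_range: "i \<in> {1..m0} \<Longrightarrow> c i \<in> {0..1}"
    and C_range: "i \<in> {1..M} \<Longrightarrow> C i \<in> {0..1}"
    and bounded_r: "spectral_bounded H lam \<phi> (\<lambda>s. r (dt * s))"
    and bounded_p: "i \<in> {1..m0} \<Longrightarrow> spectral_bounded H lam \<phi> (\<lambda>s. p i (dt * s))"
    and bounded_R: "spectral_bounded H lam \<phi> (\<lambda>s. R (\<tau> * s))"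
    and bounded_P: "i \<in> {1..M} \<Longrightarrow> spectral_bounded H lam \<phi> (\<lambda>s. P i (\<tau> * s))"
    and bounded_R1: "spectral_bounded H lam \<phi> (\<lambda>s. R1 \<alpha> \<beta> (\<tau> * s))"
    and bounded_R2: "spectral_bounded H lam \<phi> (\<lambda>s. R2 \<alpha> \<beta> (\<tau> * s))"
    and bounded_lead: "spectral_bounded H lam \<phi> (\<lambda>s. 1 / (\<alpha> 2 + \<beta> 2 * (\<tau> * s)))"
begin

section \<open>Fine and coarse propagators inside the time interval\<close>

lemma \<tau>_pos: "\<tau> > 0"
  using J_pos dt_pos by (simp add: \<tau>_def)

lemma \<tau>_half: "\<tau> = real (J div 2) * dt"
  using J_even by (auto simp: \<tau>_def elim!: evenE)

lemma T_eq_\<tau>: "T = real (2 * Nc) * \<tau>"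
  using T_eq by (simp add: \<tau>_def)

lemma real_mult_\<tau>_le_T: "m \<le> 2 * Nc \<Longrightarrow> real m * \<tau> \<le> T"
  unfolding T_eq_\<tau> using \<tau>_pos by (intro mult_right_mono) auto

text \<open>For the stage times of a single-step scheme: the source is known to lie in
  \<open>H\<close> only on \<open>{0..T}\<close>, which is why the membership lemmas below carry
  time constraints.\<close>

lemma single_step_time:
  assumes "a \<in> {0..1}" "0 \<le> t" "0 \<le> h" "t + h \<le> T"
  shows "t + a * h \<in> {0..T}"
proof -
  have "0 \<le> a * h" "a * h \<le> h"
    using assms by (auto intro: mult_left_le_one_le)
  then show ?thesis
    using assms by auto
qed

lemma F_mem:
  assumes "v \<in> H" "0 \<le> t" "t + dt \<le> T"
  shows "F t dt v \<in> H"
  unfolding F_def using assms dt_pos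
  by (intro single_step_mem onb bounded_r bounded_p f_mem single_step_time c_range) auto

lemma iterate_mem:
  assumes "v \<in> H" "0 \<le> t" "t + real j * dt \<le> T"
  shows "iterate_step F dt t v j \<in> H"
  using assms(3)
proof (induction j)
  case 0
  then show ?case using assms by simp
next
  case (Suc j)
  have le: "t + real j * dt + dt \<le> T"
    using Suc.prems by (simp add: algebra_simps)
  with dt_pos have "iterate_step F dt t v j \<in> H"
    by (intro Suc.IH) linarith
  with le assms dt_pos show ?case
    by (auto intro: F_mem)
qed

lemma inner_iterate_diff:
  assumes "v \<in> H" "w \<in> H" "0 \<le> t" "t + real j * dt \<le> T"
  shows "(iterate_step F dt t v j - iterate_step F dt t w j) \<bullet> \<phi> n
    = r (dt * lam n) ^ j * ((v - w) \<bullet> \<phi> n)"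
  using assms(4)
proof (induction j)
  case 0
  then show ?case by simp
next
  case (Suc j)
  have le: "t + real j * dt \<le> T"
    using Suc.prems dt_pos by (simp add: algebra_simps)
  with assms have "iterate_step F dt t v j \<in> H" "iterate_step F dt t w j \<in> H"
    by (auto intro: iterate_mem)
  then show ?case
    by (simp add: F_def inner_single_step_diff[OF onb bounded_r] Suc.IH[OF le, unfolded F_def])
qed

lemma Fh_mem: "v \<in> H \<Longrightarrow> 0 \<le> t \<Longrightarrow> t + \<tau> \<le> T \<Longrightarrow> Fh t v \<in> H"
  unfolding Fh_def by (rule iterate_mem) (auto simp: \<tau>_half)

lemma inner_Fh_diff:
  "v \<in> H \<Longrightarrow> w \<in> H \<Longrightarrow> 0 \<le> t \<Longrightarrow> t + \<tau> \<le> T \<Longrightarrow>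
    (Fh t v - Fh t w) \<bullet> \<phi> n = r (dt * lam n) ^ (J div 2) * ((v - w) \<bullet> \<phi> n)"
  unfolding Fh_def by (rule inner_iterate_diff) (auto simp: \<tau>_half)

lemma Ff_mem: "v \<in> H \<Longrightarrow> 0 \<le> t \<Longrightarrow> t + 2 * \<tau> \<le> T \<Longrightarrow> Ff t v \<in> H"
  unfolding Ff_def by (rule iterate_mem) (auto simp: \<tau>_def)

lemma inner_Ff_diff:
  "v \<in> H \<Longrightarrow> w \<in> H \<Longrightarrow> 0 \<le> t \<Longrightarrow> t + 2 * \<tau> \<le> T \<Longrightarrow>
    (Ff t v - Ff t w) \<bullet> \<phi> n = r (dt * lam n) ^ J * ((v - w) \<bullet> \<phi> n)"
  unfolding Ff_def by (rule inner_iterate_diff) (auto simp: \<tau>_def)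

text \<open>As \<open>J\<close> is even, the fine steps split into two runs of length
  \<open>J div 2\<close>. This joins the fine values at integer and half-integer times into one
  sequence.\<close>

lemma Ff_eq_Fh_Fh: "Ff t v = Fh (t + \<tau>) (Fh t v)"
proof -
  have "J = J div 2 + J div 2"
    using J_even by (auto elim!: evenE)
  then have "Ff t v = iterate_step F dt t v (J div 2 + J div 2)"
    by (simp add: Ff_def)
  then show ?thesis
    by (simp only: iterate_step_add Fh_def \<tau>_half)
qed

lemma G2_mem:
  assumes "v \<in> H" "w \<in> H" "\<tau> \<le> t" "t + \<tau> \<le> T"
  shows "G2 t \<tau> v w \<in> H"
proof -
  have "f (t + (real i - 1) * \<tau>) \<in> H" if "i \<le> 2" for i
  proof (rule f_mem)
    from that consider "i = 0" | "i = 1" | "i = 2"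
      by linarith
    then show "t + (real i - 1) * \<tau> \<in> {0..T}"
      using assms \<tau>_pos by cases auto
  qed
  then show ?thesis
    unfolding G2_def using assms
    by (intro two_step_mem onb bounded_R1 bounded_R2 bounded_lead)
qed

lemmas inner_G2_diff =
  inner_two_step_diff[OF onb bounded_R1 bounded_R2, of _ _ _ _ f, folded G2_def]

section \<open>The fine solution and the parareal iterates as elements of \<open>H\<close>\<close>

abbreviation Uf :: "nat \<Rightarrow> 'h" where
  "Uf \<equiv> fine_solution Fh Ff \<tau> u0"

abbreviation V :: "nat \<Rightarrow> 'h" where
  "V \<equiv> parareal_init Fh Ff G G2 \<tau> u0"

abbreviation U :: "nat \<Rightarrow> nat \<Rightarrow> 'h" where
  "U \<equiv> parareal Fh Ff G G2 \<tau> u0"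

lemma fine_0: "Uf 0 = u0"
  by (simp add: fine_solution_def)

text \<open>For odd \<open>m\<close> the definition reaches the next value by a full step from the
  preceding even index; \<open>Ff_eq_Fh_Fh\<close> turns this into a half step from
  \<open>m\<close>.\<close>

lemma fine_Suc: "Uf (Suc m) = Fh (real m * \<tau>) (Uf m)"
proof (cases "even m")
  case True
  then show ?thesis
    by (auto simp: fine_solution_def Let_def elim!: evenE) (simp add: algebra_simps)
next
  case False
  then obtain n where "m = 2 * n + 1"
    by (auto elim: oddE)
  then show ?thesis
    by (simp add: fine_solution_def Let_def Ff_eq_Fh_Fh algebra_simps)
qed

lemma fine_Suc_Suc: "Uf (Suc (Suc m)) = Ff (real m * \<tau>) (Uf m)"
  by (simp add: fine_Suc Ff_eq_Fh_Fh algebra_simps)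

lemma fine_mem: "m \<le> 2 * Nc \<Longrightarrow> Uf m \<in> H"
proof (induction m)
  case 0
  then show ?case by (simp add: fine_0 u0_mem)
next
  case (Suc m)
  then show ?case
    using real_mult_\<tau>_le_T[of "Suc m"] \<tau>_pos
    by (auto simp: fine_Suc algebra_simps intro!: Fh_mem)
qed

lemma coarse_init_mem: "m \<le> 2 * Nc \<Longrightarrow> coarse_init G G2 \<tau> u0 m \<in> H"
proof (induction m rule: less_induct)
  case (less m)
  consider "m = 0" | "m = 1" | n where "m = Suc (Suc n)"
    by (metis One_nat_def not0_implies_Suc)
  then show ?case
  proof cases
    case 1
    then show ?thesis by (simp add: u0_mem)
  next
    case 2
    have "G 0 \<tau> u0 \<in> H"
      unfolding G_def using \<tau>_pos real_mult_\<tau>_le_T[of 1] Nc_pos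
      by (intro single_step_mem onb bounded_R bounded_P f_mem single_step_time C_range u0_mem) auto
    then show ?thesis using 2 by simp
  next
    case 3
    then have "coarse_init G G2 \<tau> u0 n \<in> H" "coarse_init G G2 \<tau> u0 (Suc n) \<in> H"
      using less by auto
    then show ?thesis
      unfolding 3 coarse_init.simps
      using real_mult_\<tau>_le_T[OF less.prems] \<tau>_pos 3
      by (intro G2_mem) (auto simp: algebra_simps)
  qed
qed

lemma parareal_init_mem: "m \<le> 2 * Nc \<Longrightarrow> V m \<in> H"
  using coarse_init_mem[of m] real_mult_\<tau>_le_T[of 2] Nc_pos \<tau>_pos
  by (auto simp: parareal_init_def intro!: Fh_mem Ff_mem u0_mem)

lemma parareal_sweep_mem:
  assumes W: "\<And>m. m \<le> 2 * Nc \<Longrightarrow> W m \<in> H" and "m \<le> 2 * Nc"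
  shows "parareal_sweep Fh Ff G2 \<tau> u0 V W m \<in> H"
  using \<open>m \<le> 2 * Nc\<close>
proof (induction m rule: less_induct)
  case (less m)
  consider "m = 0" | "m = 1" | "m = 2" | n where "m = Suc (Suc (Suc n))"
    by (metis One_nat_def not0_implies_Suc numeral_2_eq_2)
  then show ?case
  proof cases
    case 4
    \<comment> \<open>The new value ends a window of length \<open>2 * \<tau>\<close> that starts at
      \<open>t\<close>, index \<open>Suc n\<close>; the two-step propagator is centred at
      \<open>t + \<tau>\<close>.\<close>
    define t where "t = real (Suc n) * \<tau>"
    have t: "0 \<le> t" "t + 2 * \<tau> \<le> T" "real (Suc n + 1) * \<tau> = t + \<tau>" "t + \<tau> \<le> T"
      using real_mult_\<tau>_le_T[OF less.prems] \<tau>_pos 4 by (auto simp: t_def algebra_simps)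
    have "parareal_sweep Fh Ff G2 \<tau> u0 V W (Suc n) \<in> H"
      "parareal_sweep Fh Ff G2 \<tau> u0 V W (Suc (Suc n)) \<in> H"
      using less 4 by auto
    moreover have "W (Suc n) \<in> H"
      using less.prems 4 by (intro W) auto
    ultimately show ?thesis
      unfolding 4 parareal_sweep.simps Let_def t(3) t_def[symmetric] using t
      by (intro subspace_diff subspace_add orthonormal_basis_subspace[OF onb] G2_mem Fh_mem Ff_mem)
        auto
  qed (use u0_mem parareal_init_mem[of 1] parareal_init_mem[of 2] less.prems in
      \<open>auto simp: numeral_2_eq_2\<close>)
qed

lemma parareal_mem: "m \<le> 2 * Nc \<Longrightarrow> U k m \<in> H"
proof (induction k arbitrary: m)
  case 0
  then show ?case by (simp add: parareal_init_mem)
next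
  case (Suc k)
  then show ?case by (simp add: parareal_sweep_mem)
qed

section \<open>Error recurrence and contraction of the coefficients\<close>

definition err :: "nat \<Rightarrow> nat \<Rightarrow> 'h" where
  "err k m = U k m - Uf m"

lemma err_mem: "m \<le> 2 * Nc \<Longrightarrow> err k m \<in> H"
  unfolding err_def
  by (intro subspace_diff orthonormal_basis_subspace[OF onb] parareal_mem fine_mem)

text \<open>Index 0 holds \<open>u0\<close>, and every sweep keeps the fine values that the
  initialization stores at indices 1 and 2. So the error recurrence, which begins at index 1, has
  zero initial data.\<close>

lemma err_start: "m \<le> 2 \<Longrightarrow> err k m = 0"
proof -
  assume "m \<le> 2"
  then consider "m = 0" | "m = Suc 0" | "m = Suc (Suc 0)"
    by linarith
  then show "err k m = 0"
    by cases (cases k; simp add: err_def parareal_init_def fine_0 fine_Suc_Suc;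
      simp add: fine_Suc fine_0)+
qed

text \<open>Numerator of the convergence factor, without the absolute value, at
  \<open>s = \<tau> * lam n\<close>, where \<open>2 * s / real J = dt * lam n\<close>.\<close>

definition defect :: "nat \<Rightarrow> real" where
  "defect n = r (dt * lam n) ^ J - R2 \<alpha> \<beta> (\<tau> * lam n) * r (dt * lam n) ^ (J div 2)
    - R1 \<alpha> \<beta> (\<tau> * lam n)"

text \<open>The fine solution is a fixed point of the sweep, because \<open>Uf (m + 1)\<close> is the half-step
  propagation of \<open>Uf m\<close>; the source terms cancel.\<close>

lemma err_recurrence:
  assumes m: "Suc (Suc (Suc m)) \<le> 2 * Nc"
  shows "err (Suc k) (Suc (Suc (Suc m))) \<bullet> \<phi> n
    - R2 \<alpha> \<beta> (\<tau> * lam n) * (err (Suc k) (Suc (Suc m)) \<bullet> \<phi> n)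
    - R1 \<alpha> \<beta> (\<tau> * lam n) * (err (Suc k) (Suc m) \<bullet> \<phi> n)
    = defect n * (err k (Suc m) \<bullet> \<phi> n)"
proof -
  define t where "t = real (Suc m) * \<tau>"
  have t: "0 \<le> t" "t + 2 * \<tau> \<le> T" "real (Suc m + 1) * \<tau> = t + \<tau>" "t + \<tau> \<le> T"
    using real_mult_\<tau>_le_T[OF m] \<tau>_pos by (auto simp: t_def algebra_simps)
  define v w where "v = U k (Suc m)" and "w = Uf (Suc m)"
  have vw: "v \<in> H" "w \<in> H"
    using m by (auto simp: v_def w_def intro: parareal_mem fine_mem)
  note Fvw = Fh_mem[OF vw(1) t(1,4)] Fh_mem[OF vw(2) t(1,4)]
  have mem: "U (Suc k) (Suc m) \<in> H" "U (Suc k) (Suc (Suc m)) \<in> H"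
    using m by (auto intro: parareal_mem simp del: parareal.simps)
  have U: "U (Suc k) (Suc (Suc (Suc m))) =
      G2 (t + \<tau>) \<tau> (U (Suc k) (Suc m)) (U (Suc k) (Suc (Suc m))) + Ff t v
      - G2 (t + \<tau>) \<tau> v (Fh t v)"
    by (simp only: parareal.simps parareal_sweep.simps Let_def t(3) v_def t_def[symmetric])
  have Uf: "Uf (Suc (Suc (Suc m))) = Ff t w" "Uf (Suc (Suc m)) = Fh t w"
    by (simp_all only: fine_Suc_Suc[of "Suc m"] fine_Suc[of "Suc m"] w_def t_def)
  \<comment> \<open>The term \<open>G2 (t + \<tau>) \<tau> w (Fh t w)\<close> is added and
    subtracted, so that each bracket compares one propagator at two arguments.\<close>
  have "err (Suc k) (Suc (Suc (Suc m))) \<bullet> \<phi> n =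
      (G2 (t + \<tau>) \<tau> (U (Suc k) (Suc m)) (U (Suc k) (Suc (Suc m)))
        - G2 (t + \<tau>) \<tau> w (Fh t w)) \<bullet> \<phi> n
      + (Ff t v - Ff t w) \<bullet> \<phi> n
      - (G2 (t + \<tau>) \<tau> v (Fh t v) - G2 (t + \<tau>) \<tau> w (Fh t w)) \<bullet> \<phi> n"
    unfolding err_def U Uf by (simp add: inner_diff_left inner_add_left)
  \<comment> \<open>The last two brackets contribute \<open>r ^ J\<close> and
    \<open>- R1 - R2 * r ^ (J / 2)\<close> times the coefficient of \<open>v - w\<close>; together
    these factors are \<open>defect n\<close>.\<close>
  also have "\<dots> = R1 \<alpha> \<beta> (\<tau> * lam n) * (err (Suc k) (Suc m) \<bullet> \<phi> n)
      + R2 \<alpha> \<beta> (\<tau> * lam n) * (err (Suc k) (Suc (Suc m)) \<bullet> \<phi> n)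
      + defect n * ((v - w) \<bullet> \<phi> n)"
    unfolding inner_G2_diff[OF mem vw(2) Fvw(2)] inner_G2_diff[OF vw(1) Fvw(1) vw(2) Fvw(2)]
      inner_Ff_diff[OF vw t(1,2)] inner_Fh_diff[OF vw t(1,4)] defect_def err_def Uf
    by (simp add: w_def algebra_simps del: parareal.simps)
  finally show ?thesis
    by (simp add: err_def v_def w_def del: parareal.simps)
qed

text \<open>The right-hand side of the error recurrence is at most
  \<open>\<bar>defect n\<bar> * B\<close> in absolute value, and the bound for two-step recurrences
  divides this by the denominator of the convergence factor.\<close>

lemma err_coefficient_step:
  assumes sum: "\<rho>1 + \<rho>2 = complex_of_real (R2 \<alpha> \<beta> (\<tau> * lam n))"
    and prod: "\<rho>1 * \<rho>2 = complex_of_real (- R1 \<alpha> \<beta> (\<tau> * lam n))"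
    and \<rho>1: "cmod \<rho>1 < 1" and \<rho>2: "cmod \<rho>2 < 1"
    and gam: "\<bar>defect n\<bar> / ((1 - cmod \<rho>1) * (1 - cmod \<rho>2)) \<le> g"
    and bound: "\<And>m. m \<le> 2 * Nc \<Longrightarrow> \<bar>err k m \<bullet> \<phi> n\<bar> \<le> B" and "m \<le> 2 * Nc"
  shows "\<bar>err (Suc k) m \<bullet> \<phi> n\<bar> \<le> g * B"
proof -
  have "0 \<le> B"
    using bound[of 0] by simp
  \<comment> \<open>The shift by one puts the two zero initial values at indices 0 and 1, and the
    last index becomes \<open>2 * Nc - 1\<close>.\<close>
  define x where "x i = err (Suc k) (Suc i) \<bullet> \<phi> n" for i
  have x: "\<bar>x i\<bar> \<le> \<bar>defect n\<bar> * B / ((1 - cmod \<rho>1) * (1 - cmod \<rho>2))" if "i \<le> 2 * Nc - 1" for i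
  proof (rule two_step_recurrence_bound[OF sum prod \<rho>1 \<rho>2 _ _ _ _ that])
    show "0 \<le> \<bar>defect n\<bar> * B" "x 0 = 0" "x 1 = 0"
      using \<open>0 \<le> B\<close> by (simp_all add: x_def err_start)
    show "\<bar>x (i + 2) - R2 \<alpha> \<beta> (\<tau> * lam n) * x (i + 1) - R1 \<alpha> \<beta> (\<tau> * lam n) * x i\<bar>
      \<le> \<bar>defect n\<bar> * B" if "i + 2 \<le> 2 * Nc - 1" for i
      using err_recurrence[of i k n] bound[of "Suc i"] that
      by (auto simp: x_def abs_mult intro: mult_left_mono)
  qed
  have "\<bar>defect n\<bar> / ((1 - cmod \<rho>1) * (1 - cmod \<rho>2)) * B \<le> g * B"
    using gam \<open>0 \<le> B\<close> by (rule mult_right_mono)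
  then have *: "\<bar>defect n\<bar> * B / ((1 - cmod \<rho>1) * (1 - cmod \<rho>2)) \<le> g * B"
    by simp
  show ?thesis
  proof (cases m)
    case 0
    \<comment> \<open>Index 0 precedes the shifted sequence; the error vanishes there, so only the
      sign of \<open>g * B\<close> is at stake.\<close>
    have "0 \<le> g * B"
      using x[of 0] * by linarith
    then show ?thesis
      using 0 by (simp add: err_start)
  next
    case (Suc i)
    then show ?thesis
      using order_trans[OF x[of i] *] \<open>m \<le> 2 * Nc\<close> by (simp add: x_def)
  qed
qed

lemma err_coefficient_bound:
  assumes "\<rho>1 + \<rho>2 = complex_of_real (R2 \<alpha> \<beta> (\<tau> * lam n))"
    and "\<rho>1 * \<rho>2 = complex_of_real (- R1 \<alpha> \<beta> (\<tau> * lam n))"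
    and "cmod \<rho>1 < 1" and "cmod \<rho>2 < 1"
    and "\<bar>defect n\<bar> / ((1 - cmod \<rho>1) * (1 - cmod \<rho>2)) \<le> g"
    and "\<And>m. m \<le> 2 * Nc \<Longrightarrow> \<bar>err 0 m \<bullet> \<phi> n\<bar> \<le> B" and "m \<le> 2 * Nc"
  shows "\<bar>err k m \<bullet> \<phi> n\<bar> \<le> g ^ k * B"
  using \<open>m \<le> 2 * Nc\<close>
proof (induction k arbitrary: m)
  case 0
  then show ?case using assms by simp
next
  case (Suc k)
  show ?case
    using err_coefficient_step[OF assms(1-5) Suc.IH Suc.prems] by (simp add: mult.assoc)
qed

text \<open>The roots may depend on \<open>n\<close>, but \<open>g\<close> is common to all
  coefficients; this uniformity lets the coefficient bounds be summed by Parseval's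
  identity.\<close>

lemma err_bound:
  assumes "0 \<le> g"
    and \<rho>: "\<And>n. \<exists>\<rho>1 \<rho>2. \<rho>1 + \<rho>2 = complex_of_real (R2 \<alpha> \<beta> (\<tau> * lam n)) \<and>
      \<rho>1 * \<rho>2 = complex_of_real (- R1 \<alpha> \<beta> (\<tau> * lam n)) \<and> cmod \<rho>1 < 1 \<and> cmod \<rho>2 < 1 \<and>
      \<bar>defect n\<bar> / ((1 - cmod \<rho>1) * (1 - cmod \<rho>2)) \<le> g"
    and m: "m \<le> 2 * Nc"
  shows "norm (err k m) \<le> g ^ k * sqrt (\<Sum>i\<le>2 * Nc. (norm (err 0 i))\<^sup>2)"
proof (rule norm_le_by_coefficients[OF onb err_mem[OF m]])
  fix n
  \<comment> \<open>This bounds the initial coefficients for all indices at once, and its square is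
    a finite sum of squares, as \<open>norm_le_by_coefficients\<close> requires.\<close>
  define B where "B = sqrt (\<Sum>i\<le>2 * Nc. (err 0 i \<bullet> \<phi> n)\<^sup>2)"
  have B: "\<bar>err 0 i \<bullet> \<phi> n\<bar> \<le> B" if "i \<le> 2 * Nc" for i
  proof -
    have "(err 0 i \<bullet> \<phi> n)\<^sup>2 \<le> (\<Sum>i\<le>2 * Nc. (err 0 i \<bullet> \<phi> n)\<^sup>2)"
      using that by (intro member_le_sum) auto
    then show ?thesis
      unfolding B_def by (metis real_sqrt_abs real_sqrt_le_iff)
  qed
  from \<rho>[of n] have "\<bar>err k m \<bullet> \<phi> n\<bar> \<le> g ^ k * B"
    using err_coefficient_bound[OF _ _ _ _ _ B m] by blast
  then have "(err k m \<bullet> \<phi> n)\<^sup>2 \<le> (g ^ k * B)\<^sup>2"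
    by (metis abs_ge_zero power2_abs power_mono)
  then show "(err k m \<bullet> \<phi> n)\<^sup>2 \<le> (g ^ k)\<^sup>2 * (\<Sum>i\<le>2 * Nc. (err 0 i \<bullet> \<phi> n)\<^sup>2)"
    by (simp add: B_def power_mult_distrib sum_nonneg)
qed (use \<open>0 \<le> g\<close> err_mem in auto)

end

section \<open>From the abstract setting to the convergence estimate\<close>

theorem theorem2:
  fixes \<Omega> :: "'a::euclidean_space set"
    and D :: "'a L2 set" and A :: "'a L2 \<Rightarrow> 'a L2"
    and lam :: "nat \<Rightarrow> real" and \<phi> :: "nat \<Rightarrow> 'a L2"
    and u0 :: "'a L2" and f :: "real \<Rightarrow> 'a L2"
    and T dt :: real and J Nc :: nat
    and r :: "real \<Rightarrow> real" and m0 :: nat and p :: "nat \<Rightarrow> real \<Rightarrow> real" and c :: "nat \<Rightarrow> real"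
    and R :: "real \<Rightarrow> real" and M :: nat and P :: "nat \<Rightarrow> real \<Rightarrow> real" and C :: "nat \<Rightarrow> real"
    and \<alpha> \<beta> :: "nat \<Rightarrow> real" and q0 :: nat
    and S :: "(real \<Rightarrow> real) \<Rightarrow> 'a L2 \<Rightarrow> 'a L2" and \<tau> :: real
    and F G :: "real \<Rightarrow> real \<Rightarrow> 'a L2 \<Rightarrow> 'a L2" and Fh Ff :: "real \<Rightarrow> 'a L2 \<Rightarrow> 'a L2"
    and G2 :: "real \<Rightarrow> real \<Rightarrow> 'a L2 \<Rightarrow> 'a L2 \<Rightarrow> 'a L2"
    and \<rho>1 \<rho>2 :: "real \<Rightarrow> complex"
  assumes "S = spectral_fun lam \<phi>"
    and "\<tau> = real J * dt / 2"
    and "F = single_step S f r m0 p c"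
    and "Fh = (\<lambda>t v. iterate_step F dt t v (J div 2))"
    and "Ff = (\<lambda>t v. iterate_step F dt t v J)"
    and "G = single_step S f R M P C"
    and "G2 = two_step S f \<alpha> \<beta>"
    and "lipschitz_domain \<Omega>"
    and "linear_operator (L2_on \<Omega>) D A" and "closure D = L2_on \<Omega>"
    and "self_adjoint (L2_on \<Omega>) D A" and "positive_definite D A" and "elliptic_operator \<Omega> D A"
    and "orthonormal_basis (L2_on \<Omega>) \<phi>"
    and "\<And>i. \<phi> i \<in> D" and "\<And>i. A (\<phi> i) = lam i *\<^sub>R \<phi> i" and "\<And>i. lam i > 0"
    and "T > 0" and "u0 \<in> L2_on \<Omega>" and "L2_time T \<Omega> f"
    and "J > 0" and "even J" and "dt > 0" and "Nc > 0" and "real Nc * (real J * dt) = T"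
    and "rational_no_poles r" and "\<And>i. i \<in> {1..m0} \<Longrightarrow> rational_no_poles (p i)"
    and "c ` {1..m0} \<subseteq> {0..1}" and "inj_on c {1..m0}"
    and "rational_no_poles R" and "\<And>i. i \<in> {1..M} \<Longrightarrow> rational_no_poles (P i)"
    and "C ` {1..M} \<subseteq> {0..1}"
    and "\<And>s. s \<ge> 0 \<Longrightarrow> \<alpha> 2 + \<beta> 2 * s \<noteq> 0"
    and "two_step_order \<alpha> \<beta> q0"
    and "spectral_bounded (L2_on \<Omega>) lam \<phi> (\<lambda>s. r (dt * s))"
    and "\<And>i. i \<in> {1..m0} \<Longrightarrow> spectral_bounded (L2_on \<Omega>) lam \<phi> (\<lambda>s. p i (dt * s))"
    and "spectral_bounded (L2_on \<Omega>) lam \<phi> (\<lambda>s. R (\<tau> * s))"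
    and "\<And>i. i \<in> {1..M} \<Longrightarrow> spectral_bounded (L2_on \<Omega>) lam \<phi> (\<lambda>s. P i (\<tau> * s))"
    and "spectral_bounded (L2_on \<Omega>) lam \<phi> (\<lambda>s. R1 \<alpha> \<beta> (\<tau> * s))"
    and "spectral_bounded (L2_on \<Omega>) lam \<phi> (\<lambda>s. R2 \<alpha> \<beta> (\<tau> * s))"
    and "spectral_bounded (L2_on \<Omega>) lam \<phi> (\<lambda>s. 1 / (\<alpha> 2 + \<beta> 2 * (\<tau> * s)))"
    and "\<And>s. s > 0 \<Longrightarrow> \<rho>1 s + \<rho>2 s = complex_of_real (R2 \<alpha> \<beta> s)"
    and "\<And>s. s > 0 \<Longrightarrow> \<rho>1 s * \<rho>2 s = complex_of_real (- R1 \<alpha> \<beta> s)"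
    and "\<And>s. s > 0 \<Longrightarrow> cmod (\<rho>1 s) < 1" and "\<And>s. s > 0 \<Longrightarrow> cmod (\<rho>2 s) < 1"
  shows "\<exists>cst::real. \<forall>k.
    ereal (MAX m\<in>{0..2 * Nc}.
      norm (parareal Fh Ff G G2 \<tau> u0 k m - fine_solution Fh Ff \<tau> u0 m))
    \<le> ereal cst * conv_factor r (R1 \<alpha> \<beta>) (R2 \<alpha> \<beta>) J \<rho>1 \<rho>2 ^ k"
proof -
  interpret two_step_parareal "L2_on \<Omega>" lam \<phi> u0 f T dt J Nc r m0 p c R M P C \<alpha> \<beta> \<tau> F G Fh Ff G2
    using assms by unfold_locales (auto simp: L2_time_def image_subset_iff)
  let ?\<gamma> = "conv_factor r (R1 \<alpha> \<beta>) (R2 \<alpha> \<beta>) J \<rho>1 \<rho>2"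
  define E where "E k = (MAX m\<in>{0..2 * Nc}. norm (err k m))" for k
  \<comment> \<open>The summand 1 makes \<open>K\<close> positive, so that
    \<open>ereal K * \<infinity>\<close> is infinite even when all initial errors vanish.\<close>
  define K where "K = 1 + sqrt (\<Sum>i\<le>2 * Nc. (norm (err 0 i))\<^sup>2)"
  have "1 \<le> K"
    by (simp add: K_def sum_nonneg)
  have \<tau>_lam: "\<tau> * lam n > 0" for n
    using \<tau>_pos \<open>\<And>i. lam i > 0\<close> by simp
  have ratio: "\<bar>defect n\<bar> / ((1 - cmod (\<rho>1 (\<tau> * lam n))) * (1 - cmod (\<rho>2 (\<tau> * lam n)))) \<le> ?\<gamma>"
    for n
  proof -
    \<comment> \<open>At \<open>s = \<tau> * lam n\<close> the argument of \<open>r\<close> in the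
      convergence factor is that of one fine step, so the ratio is a term of the supremum.\<close>
    have "2 * (\<tau> * lam n) / real J = dt * lam n"
      using J_pos by (simp add: \<open>\<tau> = real J * dt / 2\<close>)
    then show ?thesis
      unfolding conv_factor_def defect_def using \<tau>_lam[of n]
      by (intro SUP_upper2[of "\<tau> * lam n"]) auto
  qed
  \<comment> \<open>A single nonnegative term makes the supremum nonnegative; the one at eigenvalue
    index 0 serves.\<close>
  have "0 \<le> \<bar>defect 0\<bar> / ((1 - cmod (\<rho>1 (\<tau> * lam 0))) * (1 - cmod (\<rho>2 (\<tau> * lam 0))))"
    using assms(44,45)[OF \<tau>_lam[of 0]] by simp
  with ratio[of 0] have \<gamma>_nonneg: "0 \<le> ?\<gamma>"
    by (metis ereal_less_eq(5) order_trans)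
  have "ereal (E k) \<le> ereal K * ?\<gamma> ^ k" for k
  proof (cases "?\<gamma>")
    case (real g)
    with \<gamma>_nonneg have "0 \<le> g"
      by simp
    have "norm (err k m) \<le> g ^ k * K" if "m \<le> 2 * Nc" for m
    proof -
      have "norm (err k m) \<le> g ^ k * sqrt (\<Sum>i\<le>2 * Nc. (norm (err 0 i))\<^sup>2)"
      proof (rule err_bound[OF \<open>0 \<le> g\<close> _ that])
        show "\<exists>\<rho>1 \<rho>2. \<rho>1 + \<rho>2 = complex_of_real (R2 \<alpha> \<beta> (\<tau> * lam n)) \<and>
          \<rho>1 * \<rho>2 = complex_of_real (- R1 \<alpha> \<beta> (\<tau> * lam n)) \<and> cmod \<rho>1 < 1 \<and> cmod \<rho>2 < 1 \<and>
          \<bar>defect n\<bar> / ((1 - cmod \<rho>1) * (1 - cmod \<rho>2)) \<le> g" for n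
          using assms(42-45)[OF \<tau>_lam[of n]] ratio[of n]
          by (intro exI[of _ "\<rho>1 (\<tau> * lam n)"] exI[of _ "\<rho>2 (\<tau> * lam n)"]) (simp add: real)
      qed
      also have "\<dots> \<le> g ^ k * K"
        using \<open>0 \<le> g\<close> by (intro mult_left_mono) (auto simp: K_def)
      finally show ?thesis .
    qed
    then have "E k \<le> K * g ^ k"
      unfolding E_def by (subst Max_le_iff) (auto simp: mult.commute)
    then show ?thesis
      by (simp add: real)
  next
    case PInf
    \<comment> \<open>For \<open>k = 0\<close> the power of the infinite factor is 1, so the initial
      error itself has to be bounded by \<open>K\<close>; for larger \<open>k\<close> the right-hand
      side is infinite.\<close>
    show ?thesis
    proof (cases k)
      case 0
      have "norm (err 0 m) \<le> K" if "m \<le> 2 * Nc" for m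
      proof -
        have "(norm (err 0 m))\<^sup>2 \<le> (\<Sum>i\<le>2 * Nc. (norm (err 0 i))\<^sup>2)"
          using that by (intro member_le_sum) auto
        then have "norm (err 0 m) \<le> sqrt (\<Sum>i\<le>2 * Nc. (norm (err 0 i))\<^sup>2)"
          by (rule real_le_rsqrt)
        then show ?thesis
          by (simp add: K_def)
      qed
      then have "E 0 \<le> K"
        unfolding E_def by (subst Max_le_iff) auto
      then show ?thesis
        using 0 by simp
    next
      case (Suc j)
      then show ?thesis
        using \<open>1 \<le> K\<close> by (simp add: PInf)
    qed
  next
    case MInf
    then show ?thesis
      using \<gamma>_nonneg by simp
  qed
  then show ?thesis
    unfolding E_def err_def by blast
qed

end
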